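(* Consider the rigid-body angular motion $$\dot{\omega} = J_B^{-1}\left[-S(\omega)\,J_B\,\omega + n_{ext}\right],\qquad \dot{\lambda} = Q(\lambda)\,\omega ,$$ where $\lambda = [\phi\ \ \theta\ \ \psi]^T$ is the vector of Euler angles with $\theta\in(-\pi/2,\pi/2)$, $\omega\in\mathbb{R}^3$ is the angular velocity, $J_B$ is the inertia matrix and $n_{ext}\in\mathbb{R}^3$ is the external moment. Let $u_{IL} = [u_\phi\ \ u_\theta\ \ u_{\dot\psi}]^T$ be the inner-loop input vector (desired roll angle, pitch angle, and yaw angular rate), with $u_\phi,u_{\dot\psi}\in\mathbb{R}$ and $u_\theta\in(-\pi/2,\pi/2)$. Let $K_1\in\mathbb{R}^{2\times 2}$ and $K_2\in\mathbb{R}^{3\times 3}$ be positive definite diagonal matrices, and consider the control law $$n_{ext} = S(\omega)\,J_B\,\omega + J_B\,Q^{-1}(\lambda)\left[-\dot{Q}(\lambda)\,\omega - K_2\left(\dot\lambda - e_3 e_3^T u_{IL}\right) - \Pi_{e_3}^T K_1 \Pi_{e_3}\left(\lambda - u_{IL}\right)\right].$$ Then the resulting attitude dynamics is given by $$\ddot\lambda = -K_2\left(\dot\lambda - e_3e_3^T u_{IL}\right) - \Pi_{e_3}^T K_1\Pi_{e_3}\left(\lambda - u_{IL}\right),$$ which, for constant inputs $u_{IL}$, guarantees that the equilibrium point $(\Pi_{e_3}\lambda,\dot\lambda) = (\Pi_{e_3}u_{IL},\ e_3e_3^Tu_{IL})$ is exponentially stable.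
   Context: $S(\omega)\in\mathbb{R}^{3\times3}$ is the skew-symmetric matrix with $S(\omega)v=\omega\times v$ for all $v\in\mathbb{R}^3$. $J_B\in\mathbb{R}^{3\times3}$ is the constant, symmetric positive definite inertia matrix of the body. $Q(\lambda)$ is the standard matrix relating body angular velocity to Euler angle rates (roll $\phi$, pitch $\theta$, yaw $\psi$, Z-Y-X convention), $$Q(\lambda)=\begin{bmatrix}1&\sin\phi\tan\theta&\cos\phi\tan\theta\\0&\cos\phi&-\sin\phi\\0&\sin\phi/\cos\theta&\cos\phi/\cos\theta\end{bmatrix},$$ which is invertible for $\theta\in(-\pi/2,\pi/2)$; $\dot Q(\lambda)$ denotes the time derivative of $Q(\lambda(t))$ along the motion. $e_3=[0\ 0\ 1]^T$ and $\Pi_{e_3}=[\,I_2\ \ 0_{2\times1}\,]\in\mathbb{R}^{2\times3}$, so $\Pi_{e_3}\lambda=[\phi\ \theta]^T$. The state of the resulting attitude system is $(\Pi_{e_3}\lambda,\dot\lambda)\in\mathbb{R}^2\times\mathbb{R}^3$ (the yaw angle $\psi$ itself is not part of the state). Because the pitch angle is restricted to $(-\pi/2,\pi/2)$, stability is understood locally, for the motion within this domain. *)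

theory Defs
  imports "HOL-Analysis.Analysis"
begin

definition pos_def_matrix :: "real^'n^'n \<Rightarrow> bool" where
  "pos_def_matrix A \<longleftrightarrow> (\<forall>v. v \<noteq> 0 \<longrightarrow> v \<bullet> (A *v v) > 0)"

definition diagonal_matrix :: "real^'n^'n \<Rightarrow> bool" where
  "diagonal_matrix A \<longleftrightarrow> (\<forall>i j. i \<noteq> j \<longrightarrow> A $ i $ j = 0)"

definition skew :: "real^3 \<Rightarrow> real^3^3" where
  "skew w = matrix (cross3 w)"

definition e3 :: "real^3" where
  "e3 = vector [0, 0, 1]"

definition e3e3T :: "real^3^3" where
  "e3e3T = (\<chi> i j. e3 $ i * e3 $ j)"

definition Pi_e3 :: "real^3^2" where
  "Pi_e3 = vector [vector [1, 0, 0], vector [0, 1, 0]]"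

text \<open>Euler angles are ordered as roll, pitch, yaw: the pitch is the second component.\<close>

definition pitch_range :: "real set" where
  "pitch_range = {- (pi / 2) <..< pi / 2}"

definition euler_rate_matrix :: "real^3 \<Rightarrow> real^3^3" where
  "euler_rate_matrix lam =
     (let \<phi> = lam $ 1; \<theta> = lam $ 2 in
      vector [vector [1, sin \<phi> * tan \<theta>, cos \<phi> * tan \<theta>],
              vector [0, cos \<phi>, - sin \<phi>],
              vector [0, sin \<phi> / cos \<theta>, cos \<phi> / cos \<theta>]])"

definition angular_motion ::
  "real^3^3 \<Rightarrow> (real \<Rightarrow> real^3) \<Rightarrow> real set \<Rightarrow> (real \<Rightarrow> real^3) \<Rightarrow> (real \<Rightarrow> real^3) \<Rightarrow> bool" where
  "angular_motion J n_ext I lam om \<longleftrightarrow>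
     (\<forall>t\<in>I. lam t $ 2 \<in> pitch_range \<and>
        (om has_vector_derivative
           matrix_inv J *v (- (skew (om t) *v (J *v om t)) + n_ext t)) (at t within I) \<and>
        (lam has_vector_derivative euler_rate_matrix (lam t) *v om t) (at t within I))"

definition pd_term :: "real^2^2 \<Rightarrow> real^3^3 \<Rightarrow> real^3 \<Rightarrow> real^3 \<Rightarrow> real^3 \<Rightarrow> real^3" where
  "pd_term K1 K2 u lam lam_dot =
     - (K2 *v (lam_dot - e3e3T *v u))
     - (transpose Pi_e3 ** K1 ** Pi_e3) *v (lam - u)"

text \<open>The arguments \<open>lam_dot\<close> and \<open>Q_dot\<close> stand for the time derivatives, along the motion,
  of the Euler angles and of the Euler rate matrix.\<close>

definition control_law ::
  "real^3^3 \<Rightarrow> real^2^2 \<Rightarrow> real^3^3 \<Rightarrow> real^3 \<Rightarrow> real^3 \<Rightarrow> real^3 \<Rightarrow> real^3^3 \<Rightarrow> real^3 \<Rightarrow> real^3" where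
  "control_law J K1 K2 u lam lam_dot Q_dot om =
     skew om *v (J *v om)
     + J *v (matrix_inv (euler_rate_matrix lam) *v
              (- (Q_dot *v om) + pd_term K1 K2 u lam lam_dot))"

definition controlled_motion ::
  "real^3^3 \<Rightarrow> real^2^2 \<Rightarrow> real^3^3 \<Rightarrow> (real \<Rightarrow> real^3) \<Rightarrow> real set
     \<Rightarrow> (real \<Rightarrow> real^3) \<Rightarrow> (real \<Rightarrow> real^3) \<Rightarrow> bool" where
  "controlled_motion J K1 K2 u I lam om \<longleftrightarrow>
     angular_motion J
       (\<lambda>t. control_law J K1 K2 (u t) (lam t)
              (vector_derivative lam (at t within I))
              (vector_derivative (\<lambda>s. euler_rate_matrix (lam s)) (at t within I))
              (om t))
       I lam om"

definition solves_on ::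
  "('a::real_normed_vector \<Rightarrow> 'a) \<Rightarrow> 'a set \<Rightarrow> real set \<Rightarrow> (real \<Rightarrow> 'a) \<Rightarrow> bool" where
  "solves_on f D I x \<longleftrightarrow>
     (\<forall>t\<in>I. x t \<in> D \<and> (x has_vector_derivative f (x t)) (at t within I))"

text \<open>Local exponential stability of an equilibrium of \<open>x' = f x\<close> on the domain \<open>D\<close>. Every motion
  starting near the equilibrium obeys the decay estimate for as long as it is defined in \<open>D\<close>,
  and from every nearby initial state there is one that exists, in \<open>D\<close>, for all future times.\<close>

definition exponentially_stable ::
  "('a::real_normed_vector \<Rightarrow> 'a) \<Rightarrow> 'a set \<Rightarrow> 'a \<Rightarrow> bool" where
  "exponentially_stable f D xe \<longleftrightarrow>
     xe \<in> D \<and> f xe = 0 \<and>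
     (\<exists>c>0. \<exists>k>0. \<exists>\<gamma>>0. \<forall>x0\<in>D. norm (x0 - xe) < c \<longrightarrow>
        (\<exists>x. solves_on f D {0..} x \<and> x 0 = x0) \<and>
        (\<forall>I x. is_interval I \<and> 0 \<in> I \<and> I \<subseteq> {0..} \<and> solves_on f D I x \<and> x 0 = x0 \<longrightarrow>
           (\<forall>t\<in>I. norm (x t - xe) \<le> k * norm (x0 - xe) * exp (- \<gamma> * t))))"

text \<open>The state is the pair of \<open>Pi_e3 *v lam\<close> (roll and pitch) and the derivative of \<open>lam\<close>; the
  second-order equation depends on \<open>lam\<close> only through \<open>Pi_e3 *v lam\<close>.\<close>

definition attitude_field ::
  "real^2^2 \<Rightarrow> real^3^3 \<Rightarrow> real^3 \<Rightarrow> (real^2) \<times> (real^3) \<Rightarrow> (real^2) \<times> (real^3)" where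
  "attitude_field K1 K2 u = (\<lambda>(p, v).
     (Pi_e3 *v v,
      - (K2 *v (v - e3e3T *v u)) - transpose Pi_e3 *v (K1 *v (p - Pi_e3 *v u))))"

definition attitude_domain :: "((real^2) \<times> (real^3)) set" where
  "attitude_domain = {(p, v). p $ 2 \<in> pitch_range}"

definition attitude_state :: "real set \<Rightarrow> (real \<Rightarrow> real^3) \<Rightarrow> real \<Rightarrow> (real^2) \<times> (real^3)" where
  "attitude_state I lam t = (Pi_e3 *v lam t, vector_derivative lam (at t within I))"

end

theory Submission
  imports Defs
begin

text \<open>The control law cancels the gyroscopic term and the derivative of \<open>Q\<close>, so that differentiating
  \<open>\<lambda>' = Q \<omega>\<close> leaves the linear equation. As the gains are diagonal, for constant input this splits
  into two damped oscillators \<open>x'' = - c x' - a x\<close> (roll and pitch) and one first-order equation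
  (yaw rate). An oscillator decays because \<open>V = v\<^sup>2 + (v + c x)\<^sup>2 + 2 a x\<^sup>2\<close> satisfies
  \<open>V' = - 2 c (v\<^sup>2 + a x\<^sup>2)\<close>. Explicit solutions exist for all times, and the decay estimate keeps
  those that start close to the equilibrium inside the pitch range.\<close>

section \<open>Vector-valued derivatives\<close>

text \<open>The basis of \<open>'a^'n\<close> consists of the vectors \<open>axis i b\<close>, and
  the inner product with \<open>axis i b\<close> sees only component \<open>i\<close>; so
  differentiability can be tested one component at a time.\<close>

lemma has_vector_derivative_vec_iff:
  fixes f :: "real \<Rightarrow> ('a::euclidean_space)^'n"
  shows "(f has_vector_derivative f') (at t within S) \<longleftrightarrow>
         (\<forall>i. ((\<lambda>s. f s $ i) has_vector_derivative f' $ i) (at t within S))"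
proof
  assume "(f has_vector_derivative f') (at t within S)"
  then show "\<forall>i. ((\<lambda>s. f s $ i) has_vector_derivative f' $ i) (at t within S)"
    by (simp add: bounded_linear.has_vector_derivative[OF bounded_linear_vec_nth])
next
  assume *: "\<forall>i. ((\<lambda>s. f s $ i) has_vector_derivative f' $ i) (at t within S)"
  have "((\<lambda>s. f s \<bullet> axis i b) has_derivative (\<lambda>h. (h *\<^sub>R f') \<bullet> axis i b)) (at t within S)" for i b
    using bounded_linear.has_vector_derivative[OF bounded_linear_inner_left[of b] *[rule_format, of i]]
    by (simp add: has_vector_derivative_def inner_axis)
  then show "(f has_vector_derivative f') (at t within S)"
    unfolding has_vector_derivative_def
    by (subst has_derivative_componentwise_within) (auto simp: Basis_vec_def)
qed

lemma has_vector_derivative_matrix_vector_mult: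
  fixes A :: "real \<Rightarrow> real^'n^'m"
  assumes "(A has_vector_derivative A') (at t within S)"
    and "(x has_vector_derivative x') (at t within S)"
  shows "((\<lambda>s. A s *v x s) has_vector_derivative (A' *v x t + A t *v x')) (at t within S)"
proof -
  have A: "((\<lambda>s. A s $ i $ j) has_real_derivative A' $ i $ j) (at t within S)" for i j
    using assms(1) by (simp add: has_vector_derivative_vec_iff has_real_derivative_iff_has_vector_derivative)
  have x: "((\<lambda>s. x s $ j) has_real_derivative x' $ j) (at t within S)" for j
    using assms(2) by (simp add: has_vector_derivative_vec_iff has_real_derivative_iff_has_vector_derivative)
  have "((\<lambda>s. \<Sum>j\<in>UNIV. A s $ i $ j * x s $ j) has_real_derivative
        (\<Sum>j\<in>UNIV. A' $ i $ j * x t $ j + A t $ i $ j * x' $ j)) (at t within S)" for i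
    by (auto intro!: derivative_eq_intros A x sum.cong)
  then show ?thesis
    by (subst has_vector_derivative_vec_iff)
       (simp add: matrix_vector_mult_def sum.distrib has_real_derivative_iff_has_vector_derivative)
qed

text \<open>\<open>vector_derivative\<close> within \<open>I\<close> returns the actual derivative
  only where the filter is nontrivial. A nondegenerate interval has no isolated points, so this also
  covers one-sided derivatives at its ends.\<close>

lemma at_within_interval_neq_bot:
  fixes I :: "real set"
  assumes "is_interval I" "interior I \<noteq> {}" "t \<in> I"
  shows "at t within I \<noteq> bot"
proof -
  have "I \<noteq> {x}" for x
    using assms(2) by auto
  then have "t islimpt I"
    using assms connected_imp_perfect is_interval_connected by blast
  then show ?thesis
    by (simp add: trivial_limit_within)
qed

section \<open>Feedback linearization\<close>

text \<open>A vector in the kernel makes the quadratic form vanish, so the kernel is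
  trivial.\<close>

lemma pos_def_matrix_invertible:
  fixes A :: "real^'n^'n"
  assumes "pos_def_matrix A"
  shows "invertible A"
proof -
  have "x = 0" if "A *v x = 0" for x
    using assms that by (force simp: pos_def_matrix_def)
  then show ?thesis
    by (simp add: invertible_left_inverse matrix_left_invertible_ker)
qed

lemma matrix_inv_mult_cancel:
  fixes A :: "real^'n^'n"
  assumes "invertible A"
  shows "A *v (matrix_inv A *v x) = x" and "matrix_inv A *v (A *v x) = x"
proof -
  have "A ** matrix_inv A = mat 1 \<and> matrix_inv A ** A = mat 1"
    using assms unfolding invertible_def matrix_inv_def by (rule someI_ex)
  then show "A *v (matrix_inv A *v x) = x" and "matrix_inv A *v (A *v x) = x"
    by (simp_all add: matrix_vector_mul_assoc)
qed

lemma cos_pitch_pos: "\<theta> \<in> pitch_range \<Longrightarrow> cos \<theta> > 0"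
  by (auto simp: pitch_range_def intro!: cos_gt_zero_pi)

text \<open>The determinant is \<open>1 / cos \<theta>\<close>, with the numerator written as a sum
  of squares; the cosine is positive on the pitch range.\<close>

lemma invertible_euler_rate_matrix:
  assumes "lam $ 2 \<in> pitch_range"
  shows "invertible (euler_rate_matrix lam)"
proof -
  have "det (euler_rate_matrix lam) = (cos (lam $ 1) ^ 2 + sin (lam $ 1) ^ 2) / cos (lam $ 2)"
    unfolding power2_eq_square add_divide_distrib
    by (simp add: det_3 euler_rate_matrix_def Let_def del: sin_cos_squared_add3)
  then show ?thesis
    using cos_pitch_pos[OF assms] by (simp add: invertible_det_nz)
qed

text \<open>Existence suffices: the control law contains this derivative as a
  \<open>vector_derivative\<close>, and it cancels whatever its value.\<close>

lemma has_vector_derivative_euler_rate_matrix: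
  assumes lam: "(lam has_vector_derivative lam') (at t within S)"
    and pitch: "lam t $ 2 \<in> pitch_range"
  obtains D where "((\<lambda>s. euler_rate_matrix (lam s)) has_vector_derivative D) (at t within S)"
proof -
  have l: "((\<lambda>s. lam s $ i) has_real_derivative lam' $ i) (at t within S)" for i
    using lam by (simp add: has_vector_derivative_vec_iff has_real_derivative_iff_has_vector_derivative)
  have c: "cos (lam t $ 2) \<noteq> 0"
    using cos_pitch_pos[OF pitch] by simp
  note trig = DERIV_chain2[OF DERIV_sin l] DERIV_chain2[OF DERIV_cos l] DERIV_chain2[OF DERIV_tan[OF c] l]
  \<comment> \<open>For each of the nine entries the matching differentiation rule instantiates the
    unknown \<open>d\<close>.\<close>
  have "\<forall>i j. \<exists>d. ((\<lambda>s. euler_rate_matrix (lam s) $ i $ j) has_vector_derivative d) (at t within S)"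
    unfolding has_real_derivative_iff_has_vector_derivative[symmetric] forall_3
    by (intro conjI; simp add: euler_rate_matrix_def Let_def; intro exI;
        rule DERIV_const trig DERIV_minus[OF trig(1)] DERIV_mult[OF trig(1,3)]
          DERIV_mult[OF trig(2,3)] DERIV_divide[OF trig(1,2) c] DERIV_divide[OF trig(2,2) c])
  then obtain d where
    "\<And>i j. ((\<lambda>s. euler_rate_matrix (lam s) $ i $ j) has_vector_derivative d i j) (at t within S)"
    by metis
  then have "((\<lambda>s. euler_rate_matrix (lam s)) has_vector_derivative (\<chi> i j. d i j)) (at t within S)"
    by (simp add: has_vector_derivative_vec_iff)
  then show thesis
    by (rule that)
qed

text \<open>The input may vary with time: only \<open>om\<close> and the Euler rate matrix are
  differentiated, so no derivative of \<open>u\<close> appears.\<close>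

lemma controlled_motion_second_order:
  assumes J: "pos_def_matrix J"
    and I: "is_interval I" "interior I \<noteq> {}"
    and motion: "controlled_motion J K1 K2 u I lam om"
    and t: "t \<in> I"
  shows "(lam has_vector_derivative vector_derivative lam (at t within I)) (at t within I)"
    and "((\<lambda>s. vector_derivative lam (at s within I)) has_vector_derivative
            pd_term K1 K2 (u t) (lam t) (vector_derivative lam (at t within I))) (at t within I)"
    and "lam t $ 2 \<in> pitch_range"
proof -
  let ?Q = "\<lambda>s. euler_rate_matrix (lam s)"
  let ?pd = "pd_term K1 K2 (u t) (lam t) (vector_derivative lam (at t within I))"
  let ?Qd = "vector_derivative ?Q (at t within I)"
  have am: "lam s $ 2 \<in> pitch_range"
      "(om has_vector_derivative matrix_inv J *v (- (skew (om s) *v (J *v om s)) +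
          control_law J K1 K2 (u s) (lam s) (vector_derivative lam (at s within I))
            (vector_derivative ?Q (at s within I)) (om s))) (at s within I)"
      "(lam has_vector_derivative ?Q s *v om s) (at s within I)" if "s \<in> I" for s
    using motion that by (auto simp: controlled_motion_def angular_motion_def)
  \<comment> \<open>Needed on all of \<open>I\<close>, not just at \<open>t\<close>, because this
    function of \<open>s\<close> is itself differentiated below.\<close>
  have vd: "vector_derivative lam (at s within I) = ?Q s *v om s" if "s \<in> I" for s
    by (rule vector_derivative_within[OF at_within_interval_neq_bot[OF I that] am(3)[OF that]])
  show "lam t $ 2 \<in> pitch_range"
    by (rule am(1)[OF t])
  show "(lam has_vector_derivative vector_derivative lam (at t within I)) (at t within I)"
    using am(3)[OF t] vd[OF t] by simp
  obtain D where "(?Q has_vector_derivative D) (at t within I)"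
    by (rule has_vector_derivative_euler_rate_matrix[OF am(3)[OF t] am(1)[OF t]])
  then have Q: "(?Q has_vector_derivative ?Qd) (at t within I)"
    using vector_derivative_within[OF at_within_interval_neq_bot[OF I t]] by metis
  have om: "(om has_vector_derivative matrix_inv (?Q t) *v (- (?Qd *v om t) + ?pd)) (at t within I)"
    using am(2)[OF t]
    by (simp add: control_law_def matrix_inv_mult_cancel(2)[OF pos_def_matrix_invertible[OF J]])
  \<comment> \<open>The product rule gives \<open>?Qd *v om t\<close> plus \<open>?Q t\<close>
    applied to the derivative of \<open>om\<close>; the second summand contributes
    \<open>- (?Qd *v om t) + ?pd\<close>.\<close>
  have "((\<lambda>s. ?Q s *v om s) has_vector_derivative ?pd) (at t within I)"
    using has_vector_derivative_matrix_vector_mult[OF Q om]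
    by (simp add: matrix_inv_mult_cancel(1)[OF invertible_euler_rate_matrix[OF am(1)[OF t]]])
  then show "((\<lambda>s. vector_derivative lam (at s within I)) has_vector_derivative ?pd) (at t within I)"
    by (rule has_vector_derivative_transform[where f = "\<lambda>s. ?Q s *v om s", OF t, rotated]) (rule vd)
qed

section \<open>From the controlled motion to the state equation\<close>

lemma Pi_e3_mult_nth: "(Pi_e3 *v v) $ 1 = v $ 1" "(Pi_e3 *v v) $ 2 = v $ 2"
  by (simp_all add: Pi_e3_def matrix_vector_mult_def sum_3)

text \<open>\<open>Pi_e3\<close> is constant and linear, so it commutes with differentiation, and
  regrouping the position term as \<open>transpose Pi_e3\<close> applied to
  \<open>K1 *v (Pi_e3 *v lam t - Pi_e3 *v u)\<close> removes the yaw angle.\<close>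

lemma controlled_motion_attitude_state:
  assumes "pos_def_matrix J" "is_interval I" "interior I \<noteq> {}"
    and "controlled_motion J K1 K2 (\<lambda>_. u) I lam om"
  shows "solves_on (attitude_field K1 K2 u) attitude_domain I (attitude_state I lam)"
  unfolding solves_on_def
proof (intro ballI conjI)
  fix t assume t: "t \<in> I"
  note so = controlled_motion_second_order[OF assms t]
  show "attitude_state I lam t \<in> attitude_domain"
    using so(3) by (simp add: attitude_state_def attitude_domain_def Pi_e3_mult_nth)
  have "((\<lambda>s. Pi_e3 *v lam s) has_vector_derivative
          Pi_e3 *v vector_derivative lam (at t within I)) (at t within I)"
    by (rule bounded_linear.has_vector_derivative[OF matrix_vector_mul_bounded_linear so(1)])
  from has_vector_derivative_Pair[OF this so(2)]
  show "(attitude_state I lam has_vector_derivative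
          attitude_field K1 K2 u (attitude_state I lam t)) (at t within I)"
    by (simp add: attitude_state_def[abs_def] attitude_field_def pd_term_def
        matrix_vector_mul_assoc[symmetric] matrix_vector_mult_diff_distrib)
qed

section \<open>Damped scalar equations\<close>

text \<open>A Gronwall argument: \<open>V s * exp (\<gamma> * s)\<close> has nonpositive
  derivative.\<close>

lemma exponential_decay:
  fixes V V' :: "real \<Rightarrow> real"
  assumes I: "is_interval I" "0 \<in> I" "t \<in> I" "0 \<le> t"
    and der: "\<And>s. s \<in> I \<Longrightarrow> (V has_real_derivative V' s) (at s within I)"
    and le: "\<And>s. s \<in> I \<Longrightarrow> V' s \<le> - \<gamma> * V s"
  shows "V t \<le> V 0 * exp (- \<gamma> * t)"
proof -
  define W where "W s = V s * exp (\<gamma> * s)" for s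
  have sub: "{0..t} \<subseteq> I"
    using mem_is_interval_1_I[OF I(1-3)] by auto
  have W: "(W has_real_derivative (V' s + \<gamma> * V s) * exp (\<gamma> * s)) (at s within {0..t})"
    if "s \<in> {0..t}" for s
    unfolding W_def using that sub
    by (auto intro!: derivative_eq_intros DERIV_subset[OF der sub] simp: algebra_simps)
  have "W t \<le> W 0"
  proof (rule DERIV_nonpos_imp_decreasing_open[OF \<open>0 \<le> t\<close>])
    show "continuous_on {0..t} W"
      using W by (rule DERIV_continuous_on)
    fix s assume s: "0 < s" "s < t"
    \<comment> \<open>At interior points the derivative within the interval is two-sided, as the
      monotonicity criterion demands.\<close>
    then have "(W has_real_derivative (V' s + \<gamma> * V s) * exp (\<gamma> * s)) (at s)"
      using W[of s] at_within_Icc_at[of 0 s t] by simp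
    moreover have "(V' s + \<gamma> * V s) * exp (\<gamma> * s) \<le> 0"
      using le[OF subsetD[OF sub, of s]] s by (intro mult_nonpos_nonneg) auto
    ultimately show "\<exists>y. DERIV W s :> y \<and> y \<le> 0"
      by blast
  qed
  then have "V t * exp (\<gamma> * t) * exp (- \<gamma> * t) \<le> V 0 * exp (- \<gamma> * t)"
    by (intro mult_right_mono) (simp_all add: W_def)
  then show ?thesis
    by (simp add: mult.assoc flip: exp_add)
qed

text \<open>The constants depend on \<open>a\<close> and \<open>c\<close> only; they are uniform
  over intervals, solutions and times.\<close>

lemma damped_oscillator_decay:
  fixes a c :: real
  assumes a: "a > 0" and c: "c > 0"
  obtains k \<gamma> where "k > 0" "\<gamma> > 0"
    "\<And>I x v t. is_interval I \<Longrightarrow> 0 \<in> I \<Longrightarrow> t \<in> I \<Longrightarrow> 0 \<le> t \<Longrightarrow>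
       (\<And>s. s \<in> I \<Longrightarrow> (x has_real_derivative v s) (at s within I)) \<Longrightarrow>
       (\<And>s. s \<in> I \<Longrightarrow> (v has_real_derivative - c * v s - a * x s) (at s within I)) \<Longrightarrow>
       (x t)\<^sup>2 + (v t)\<^sup>2 \<le> k * ((x 0)\<^sup>2 + (v 0)\<^sup>2) * exp (- \<gamma> * t)"
proof -
  define V where "V x v = v\<^sup>2 + (v + c * x)\<^sup>2 + 2 * a * x\<^sup>2" for x v :: real
  \<comment> \<open>\<open>M\<close> compares \<open>V\<close> with the dissipated quantity
    \<open>v\<^sup>2 + a * x\<^sup>2\<close>, giving the rate \<open>2 * c / M\<close>;
    \<open>m\<close> and \<open>N\<close> compare \<open>V\<close> with the squared norm, giving the
    factor \<open>N / m\<close>.\<close>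
  define M where "M = 3 + 2 * (c\<^sup>2 + a) / a"
  define m where "m = min 1 (2 * a)"
  define N where "N = 3 + 2 * (c\<^sup>2 + a)"
  have M: "M > 0" and m: "m > 0" and N: "N > 0"
    using a by (simp_all add: M_def m_def N_def add_pos_nonneg)
  \<comment> \<open>The cross term satisfies
    \<open>2 * v * (c * x) \<le> v\<^sup>2 + (c * x)\<^sup>2\<close>.\<close>
  have V_le: "V x v \<le> 3 * v\<^sup>2 + 2 * (c\<^sup>2 + a) * x\<^sup>2" for x v
    using sum_squares_bound[of v "c * x"]
    by (simp add: V_def power2_sum power_mult_distrib algebra_simps)
  have V_M: "V x v \<le> M * (v\<^sup>2 + a * x\<^sup>2)" for x v
  proof -
    have "M * (v\<^sup>2 + a * x\<^sup>2) - (3 * v\<^sup>2 + 2 * (c\<^sup>2 + a) * x\<^sup>2) = 2 * (c\<^sup>2 + a) / a * v\<^sup>2 + 3 * a * x\<^sup>2"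
      using a by (simp add: M_def field_simps)
    also have "\<dots> \<ge> 0"
      using a by simp
    finally show ?thesis
      using V_le[of x v] by linarith
  qed
  have V_N: "V x v \<le> N * (x\<^sup>2 + v\<^sup>2)" for x v
  proof -
    have "N * (x\<^sup>2 + v\<^sup>2) - (3 * v\<^sup>2 + 2 * (c\<^sup>2 + a) * x\<^sup>2) = 2 * (c\<^sup>2 + a) * v\<^sup>2 + 3 * x\<^sup>2"
      by (simp add: N_def algebra_simps)
    also have "\<dots> \<ge> 0"
      using a by simp
    finally show ?thesis
      using V_le[of x v] by linarith
  qed
  have V_m: "m * (x\<^sup>2 + v\<^sup>2) \<le> V x v" for x v
  proof -
    have "m * x\<^sup>2 \<le> 2 * a * x\<^sup>2" "m * v\<^sup>2 \<le> 1 * v\<^sup>2"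
      by (rule mult_right_mono; simp add: m_def)+
    then show ?thesis
      unfolding V_def distrib_left using zero_le_power2[of "v + c * x"] by linarith
  qed
  show thesis
  proof (rule that[of "N / m" "2 * c / M"])
    fix I x v t
    assume I: "is_interval I" "0 \<in> I" "t \<in> I" "(0::real) \<le> t"
      and x: "\<And>s. s \<in> I \<Longrightarrow> (x has_real_derivative v s) (at s within I)"
      and v: "\<And>s. s \<in> I \<Longrightarrow> (v has_real_derivative - c * v s - a * x s) (at s within I)"
    have "V (x t) (v t) \<le> V (x 0) (v 0) * exp (- (2 * c / M) * t)"
    proof (rule exponential_decay[OF I])
      fix s assume s: "s \<in> I"
      show "((\<lambda>s. V (x s) (v s)) has_real_derivative - 2 * c * ((v s)\<^sup>2 + a * (x s)\<^sup>2)) (at s within I)"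
        unfolding V_def
        by (auto intro!: derivative_eq_intros x[OF s] v[OF s] simp: algebra_simps power2_eq_square)
      show "- 2 * c * ((v s)\<^sup>2 + a * (x s)\<^sup>2) \<le> - (2 * c / M) * V (x s) (v s)"
        using mult_left_mono[OF V_M[of "x s" "v s"], of "2 * c / M"] M c by simp
    qed
    then have "m * ((x t)\<^sup>2 + (v t)\<^sup>2) \<le> V (x 0) (v 0) * exp (- (2 * c / M) * t)"
      using V_m order_trans by blast
    also have "\<dots> \<le> N * ((x 0)\<^sup>2 + (v 0)\<^sup>2) * exp (- (2 * c / M) * t)"
      by (intro mult_right_mono V_N) simp
    finally show "(x t)\<^sup>2 + (v t)\<^sup>2 \<le> N / m * ((x 0)\<^sup>2 + (v 0)\<^sup>2) * exp (- (2 * c / M) * t)"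
      using m by (simp add: field_simps)
  qed (use M m N c in simp_all)
qed

section \<open>Explicit solutions of the oscillator equations\<close>

text \<open>A fundamental system of \<open>y'' = - d * y\<close>, hyperbolic, polynomial or
  trigonometric by the sign of \<open>d\<close>. All signs occur, since the oscillators may be
  over-, critically or underdamped.\<close>

lemma harmonic_solution:
  fixes d :: real
  obtains C S :: "real \<Rightarrow> real" where "C 0 = 1" "S 0 = 0"
    "\<And>t. (C has_real_derivative - d * S t) (at t)" "\<And>t. (S has_real_derivative C t) (at t)"
proof (cases d "0::real" rule: linorder_cases)
  case less
  define r where "r = sqrt (- d)"
  have r: "r \<noteq> 0" "d = - r * r"
    using less by (simp_all add: r_def)
  show ?thesis
    by (rule that[of "\<lambda>t. cosh (r * t)" "\<lambda>t. sinh (r * t) / r"])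
       (auto simp: r intro!: derivative_eq_intros)
next
  case equal
  show ?thesis
    by (rule that[of "\<lambda>_. 1" "\<lambda>t. t"]) (auto simp: equal intro!: derivative_eq_intros)
next
  case greater
  define r where "r = sqrt d"
  have r: "r \<noteq> 0" "d = r * r"
    using greater by (simp_all add: r_def)
  show ?thesis
    by (rule that[of "\<lambda>t. cos (r * t)" "\<lambda>t. sin (r * t) / r"])
       (auto simp: r intro!: derivative_eq_intros)
qed

text \<open>Writing \<open>x = exp (- c / 2 * t) * y\<close> removes the damping:
  \<open>y'' = - (a - c\<^sup>2 / 4) * y\<close>.\<close>

lemma damped_oscillator_solution:
  fixes a c x0 v0 :: real
  obtains x v where "x 0 = x0" "v 0 = v0"
    "\<And>t. (x has_real_derivative v t) (at t)"
    "\<And>t. (v has_real_derivative - c * v t - a * x t) (at t)"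
proof -
  obtain C S :: "real \<Rightarrow> real" where CS: "C 0 = 1" "S 0 = 0"
    "\<And>t. (C has_real_derivative - (a - c\<^sup>2 / 4) * S t) (at t)"
    "\<And>t. (S has_real_derivative C t) (at t)"
    using harmonic_solution[of "a - c\<^sup>2 / 4"] by metis
  \<comment> \<open>The initial value of \<open>y'\<close>, obtained from
    \<open>v = E * (y' - c / 2 * y)\<close> at time 0.\<close>
  define w0 where "w0 = v0 + c / 2 * x0"
  define y where "y t = x0 * C t + w0 * S t" for t
  define y' where "y' t = w0 * C t - (a - c\<^sup>2 / 4) * x0 * S t" for t
  have y: "(y has_real_derivative y' t) (at t)"
    "(y' has_real_derivative - (a - c\<^sup>2 / 4) * y t) (at t)" for t
    unfolding y_def[abs_def] y'_def[abs_def]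
    by (auto intro!: derivative_eq_intros CS simp: algebra_simps)
  define E where "E t = exp (- c / 2 * t)" for t :: real
  have E: "(E has_real_derivative - c / 2 * E t) (at t)" for t
    unfolding E_def[abs_def] by (auto intro!: derivative_eq_intros)
  show thesis
  proof (rule that[of "\<lambda>t. E t * y t" "\<lambda>t. E t * (y' t - c / 2 * y t)"])
    fix t
    show "((\<lambda>t. E t * y t) has_real_derivative E t * (y' t - c / 2 * y t)) (at t)"
      by (auto intro!: derivative_eq_intros E y simp: algebra_simps)
    show "((\<lambda>t. E t * (y' t - c / 2 * y t)) has_real_derivative
        - c * (E t * (y' t - c / 2 * y t)) - a * (E t * y t)) (at t)"
      by (auto intro!: derivative_eq_intros E y simp: field_simps power2_eq_square)
  qed (simp_all add: E_def y_def y'_def w0_def CS)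
qed

section \<open>Stability of the attitude dynamics\<close>

lemma pos_def_matrix_diagonal_entry_pos:
  fixes A :: "real^'n^'n"
  assumes "pos_def_matrix A"
  shows "A $ i $ i > 0"
proof -
  have "axis i 1 \<bullet> (A *v axis i 1) > 0"
    using assms by (simp add: pos_def_matrix_def axis_eq_0_iff)
  then show ?thesis
    by (simp add: matrix_vector_mult_basis column_def inner_axis')
qed

lemma diagonal_matrix_mult_nth:
  fixes A :: "real^'n^'n"
  assumes "diagonal_matrix A"
  shows "(A *v x) $ i = A $ i $ i * x $ i"
proof -
  have "(A *v x) $ i = (\<Sum>j\<in>UNIV. if j = i then A $ i $ i * x $ i else 0)"
    unfolding matrix_vector_mult_def vec_lambda_beta
    by (intro sum.cong) (use assms in \<open>auto simp: diagonal_matrix_def\<close>)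
  then show ?thesis
    by simp
qed

lemma e3e3T_mult_nth: "(e3e3T *v u) $ 1 = 0" "(e3e3T *v u) $ 2 = 0" "(e3e3T *v u) $ 3 = u $ 3"
  by (simp_all add: e3e3T_def e3_def matrix_vector_mult_def sum_3)

lemma transpose_Pi_e3_mult_nth:
  "(transpose Pi_e3 *v p) $ 1 = p $ 1" "(transpose Pi_e3 *v p) $ 2 = p $ 2"
  "(transpose Pi_e3 *v p) $ 3 = 0"
  by (simp_all add: Pi_e3_def transpose_def matrix_vector_mult_def sum_2)

lemmas attitude_nth = Pi_e3_mult_nth e3e3T_mult_nth transpose_Pi_e3_mult_nth

text \<open>The squares are grouped by the decoupled subsystems: roll, pitch, yaw rate.\<close>

lemma norm_pair_vec_2_3:
  fixes p :: "real^2" and v :: "real^3"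
  shows "(norm (p, v))\<^sup>2 = ((p $ 1)\<^sup>2 + (v $ 1)\<^sup>2) + ((p $ 2)\<^sup>2 + (v $ 2)\<^sup>2) + (v $ 3)\<^sup>2"
  unfolding power2_norm_eq_inner by (simp add: inner_vec_def sum_2 sum_3 power2_eq_square)

text \<open>Diagonal gains decouple the field. Only the angles and the yaw rate are shifted, since
  the equilibrium roll and pitch rates are zero.\<close>

lemma has_vector_derivative_attitude_iff:
  assumes "diagonal_matrix K1" "diagonal_matrix K2"
  shows "((\<lambda>s. (p s, v s)) has_vector_derivative attitude_field K1 K2 u (p t, v t)) (at t within I) \<longleftrightarrow>
    ((\<lambda>s. p s $ 1 - u $ 1) has_real_derivative v t $ 1) (at t within I) \<and>
    ((\<lambda>s. v s $ 1) has_real_derivative - K2 $ 1 $ 1 * v t $ 1 - K1 $ 1 $ 1 * (p t $ 1 - u $ 1)) (at t within I) \<and>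
    ((\<lambda>s. p s $ 2 - u $ 2) has_real_derivative v t $ 2) (at t within I) \<and>
    ((\<lambda>s. v s $ 2) has_real_derivative - K2 $ 2 $ 2 * v t $ 2 - K1 $ 2 $ 2 * (p t $ 2 - u $ 2)) (at t within I) \<and>
    ((\<lambda>s. v s $ 3 - u $ 3) has_real_derivative - K2 $ 3 $ 3 * (v t $ 3 - u $ 3)) (at t within I)"
proof -
  have shift: "((\<lambda>s. f s - b) has_vector_derivative D) F \<longleftrightarrow> (f has_vector_derivative D) F"
    for f :: "real \<Rightarrow> real" and b D F
    using has_vector_derivative_diff[OF _ has_vector_derivative_const[of b F], of f D]
      has_vector_derivative_add[OF _ has_vector_derivative_const[of b F], of "\<lambda>s. f s - b" D]
    by auto
  have pair: "((\<lambda>s. (p s, v s)) has_vector_derivative (p', v')) (at t within I) \<longleftrightarrow>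
      (p has_vector_derivative p') (at t within I) \<and> (v has_vector_derivative v') (at t within I)" for p' v'
    using bounded_linear.has_vector_derivative[OF bounded_linear_fst, of "\<lambda>s. (p s, v s)" "(p', v')"]
      bounded_linear.has_vector_derivative[OF bounded_linear_snd, of "\<lambda>s. (p s, v s)" "(p', v')"]
    by (auto intro: has_vector_derivative_Pair)
  show ?thesis
    \<comment> \<open>The deleted rule would rewrite \<open>transpose Pi_e3 *v _\<close> to a
      vector-matrix product, to which the component rules do not apply.\<close>
    by (auto simp: attitude_field_def pair has_vector_derivative_vec_iff forall_2 forall_3 shift
        diagonal_matrix_mult_nth[OF assms(1)] diagonal_matrix_mult_nth[OF assms(2)] attitude_nth
        has_real_derivative_iff_has_vector_derivative simp del: transpose_matrix_vector)
qed

section \<open>Decay estimate and local exponential stability\<close>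

text \<open>Stated on \<open>UNIV\<close>, so that the estimate can later be used to prove that
  solutions stay in the pitch range.\<close>

lemma attitude_decay:
  assumes K1: "diagonal_matrix K1" "pos_def_matrix K1"
    and K2: "diagonal_matrix K2" "pos_def_matrix K2"
  obtains k \<gamma> where "k > 0" "\<gamma> > 0"
    "\<And>I x t. is_interval I \<Longrightarrow> 0 \<in> I \<Longrightarrow> I \<subseteq> {0..} \<Longrightarrow> solves_on (attitude_field K1 K2 u) UNIV I x \<Longrightarrow>
       t \<in> I \<Longrightarrow>
       norm (x t - (Pi_e3 *v u, e3e3T *v u)) \<le>
         k * norm (x 0 - (Pi_e3 *v u, e3e3T *v u)) * exp (- \<gamma> * t)"
proof -
  note pos1 = pos_def_matrix_diagonal_entry_pos[OF K1(2)]
  note pos2 = pos_def_matrix_diagonal_entry_pos[OF K2(2)]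
  obtain k1 \<gamma>1 where 1: "k1 > 0" "\<gamma>1 > 0"
    "\<And>I x v t. is_interval I \<Longrightarrow> 0 \<in> I \<Longrightarrow> t \<in> I \<Longrightarrow> 0 \<le> t \<Longrightarrow>
       (\<And>s. s \<in> I \<Longrightarrow> (x has_real_derivative v s) (at s within I)) \<Longrightarrow>
       (\<And>s. s \<in> I \<Longrightarrow> (v has_real_derivative - K2 $ 1 $ 1 * v s - K1 $ 1 $ 1 * x s) (at s within I)) \<Longrightarrow>
       (x t)\<^sup>2 + (v t)\<^sup>2 \<le> k1 * ((x 0)\<^sup>2 + (v 0)\<^sup>2) * exp (- \<gamma>1 * t)"
    by (rule damped_oscillator_decay[OF pos1 pos2]) (blast intro: that)
  obtain k2 \<gamma>2 where 2: "k2 > 0" "\<gamma>2 > 0"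
    "\<And>I x v t. is_interval I \<Longrightarrow> 0 \<in> I \<Longrightarrow> t \<in> I \<Longrightarrow> 0 \<le> t \<Longrightarrow>
       (\<And>s. s \<in> I \<Longrightarrow> (x has_real_derivative v s) (at s within I)) \<Longrightarrow>
       (\<And>s. s \<in> I \<Longrightarrow> (v has_real_derivative - K2 $ 2 $ 2 * v s - K1 $ 2 $ 2 * x s) (at s within I)) \<Longrightarrow>
       (x t)\<^sup>2 + (v t)\<^sup>2 \<le> k2 * ((x 0)\<^sup>2 + (v 0)\<^sup>2) * exp (- \<gamma>2 * t)"
    by (rule damped_oscillator_decay[OF pos1 pos2]) (blast intro: that)
  \<comment> \<open>Twice the gain, because the square of the yaw rate error is estimated.\<close>
  define \<gamma>3 where "\<gamma>3 = 2 * K2 $ 3 $ 3"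
  define \<gamma> where "\<gamma> = min \<gamma>1 (min \<gamma>2 \<gamma>3)"
  define k where "k = k1 + k2 + 1"
  have k: "k > 0" and \<gamma>: "\<gamma> > 0"
    using 1 2 pos2 by (simp_all add: k_def \<gamma>_def \<gamma>3_def)
  let ?xe = "(Pi_e3 *v u, e3e3T *v u)"
  show thesis
  \<comment> \<open>The three estimates add up to one for the squared norm; taking roots halves the
    rate.\<close>
  proof (rule that[of "sqrt k" "\<gamma> / 2"])
    fix I x t
    assume I: "is_interval I" "0 \<in> I" "I \<subseteq> {0..}"
      and sol: "solves_on (attitude_field K1 K2 u) UNIV I x" and t: "t \<in> I"
    define p v where "p s = fst (x s)" and "v s = snd (x s)" for s
    have x: "x s = (p s, v s)" for s
      by (simp add: p_def v_def)
    have t0: "0 \<le> t"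
      using I t by auto
    have "((\<lambda>s. (p s, v s)) has_vector_derivative attitude_field K1 K2 u (p s, v s)) (at s within I)"
      if "s \<in> I" for s
      using sol that by (simp add: solves_on_def flip: x)
    note der = this[unfolded has_vector_derivative_attitude_iff[OF K1(1) K2(1)]]
    have n: "(norm (x s - ?xe))\<^sup>2 = ((p s $ 1 - u $ 1)\<^sup>2 + (v s $ 1)\<^sup>2) +
        ((p s $ 2 - u $ 2)\<^sup>2 + (v s $ 2)\<^sup>2) + (v s $ 3 - u $ 3)\<^sup>2" for s
      by (simp add: x norm_pair_vec_2_3 attitude_nth)
    \<comment> \<open>Each subsystem estimate is relaxed to the common larger factor and slower
      rate, which is sound for \<open>t \<ge> 0\<close>.\<close>
    have weaken: "X \<le> k * X0 * exp (- \<gamma> * t)"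
      if "X \<le> k' * X0 * exp (- \<gamma>' * t)" "0 \<le> X0" "0 \<le> k'" "k' \<le> k" "\<gamma> \<le> \<gamma>'" for X X0 k' \<gamma>'
    proof -
      have "- \<gamma>' * t \<le> - \<gamma> * t"
        using mult_right_mono[OF that(5) t0] by simp
      then have "k' * X0 * exp (- \<gamma>' * t) \<le> k * X0 * exp (- \<gamma> * t)"
        using that k by (intro mult_mono) auto
      with that show ?thesis
        by linarith
    qed
    have "(p t $ 1 - u $ 1)\<^sup>2 + (v t $ 1)\<^sup>2 \<le>
        k1 * ((p 0 $ 1 - u $ 1)\<^sup>2 + (v 0 $ 1)\<^sup>2) * exp (- \<gamma>1 * t)"
      using der by (intro 1(3)[OF I(1,2) t t0]) auto
    then have a1: "(p t $ 1 - u $ 1)\<^sup>2 + (v t $ 1)\<^sup>2 \<le>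
        k * ((p 0 $ 1 - u $ 1)\<^sup>2 + (v 0 $ 1)\<^sup>2) * exp (- \<gamma> * t)"
      by (rule weaken) (use 1 2 in \<open>auto simp: k_def \<gamma>_def\<close>)
    have "(p t $ 2 - u $ 2)\<^sup>2 + (v t $ 2)\<^sup>2 \<le>
        k2 * ((p 0 $ 2 - u $ 2)\<^sup>2 + (v 0 $ 2)\<^sup>2) * exp (- \<gamma>2 * t)"
      using der by (intro 2(3)[OF I(1,2) t t0]) auto
    then have a2: "(p t $ 2 - u $ 2)\<^sup>2 + (v t $ 2)\<^sup>2 \<le>
        k * ((p 0 $ 2 - u $ 2)\<^sup>2 + (v 0 $ 2)\<^sup>2) * exp (- \<gamma> * t)"
      by (rule weaken) (use 1 2 in \<open>auto simp: k_def \<gamma>_def\<close>)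
    have "(v t $ 3 - u $ 3)\<^sup>2 \<le> (v 0 $ 3 - u $ 3)\<^sup>2 * exp (- \<gamma>3 * t)"
    proof (rule exponential_decay[OF I(1,2) t t0])
      fix s assume s: "s \<in> I"
      have d: "((\<lambda>s. v s $ 3 - u $ 3) has_real_derivative - K2 $ 3 $ 3 * (v s $ 3 - u $ 3)) (at s within I)"
        using der[OF s] by blast
      show "((\<lambda>s. (v s $ 3 - u $ 3)\<^sup>2) has_real_derivative - \<gamma>3 * (v s $ 3 - u $ 3)\<^sup>2) (at s within I)"
        by (rule DERIV_cong[OF DERIV_power[OF d, of 2]]) (simp add: \<gamma>3_def power2_eq_square)
    qed simp
    then have "(v t $ 3 - u $ 3)\<^sup>2 \<le> 1 * (v 0 $ 3 - u $ 3)\<^sup>2 * exp (- \<gamma>3 * t)"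
      by simp
    then have a3: "(v t $ 3 - u $ 3)\<^sup>2 \<le> k * (v 0 $ 3 - u $ 3)\<^sup>2 * exp (- \<gamma> * t)"
      by (rule weaken) (use 1 2 in \<open>auto simp: k_def \<gamma>_def\<close>)
    have "(norm (x t - ?xe))\<^sup>2 \<le> k * (norm (x 0 - ?xe))\<^sup>2 * exp (- \<gamma> * t)"
      using a1 a2 a3 by (simp add: n algebra_simps)
    also have "\<dots> = (sqrt k * norm (x 0 - ?xe) * exp (- (\<gamma> / 2) * t))\<^sup>2"
      using k by (simp add: power_mult_distrib flip: exp_double)
    finally show "norm (x t - ?xe) \<le> sqrt k * norm (x 0 - ?xe) * exp (- (\<gamma> / 2) * t)"
      by (rule power2_le_imp_le) (use k in simp)
  qed (use k \<gamma> in simp_all)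
qed

text \<open>Two explicit oscillators and one exponential are assembled in error coordinates and
  shifted back by \<open>u\<close>.\<close>

lemma attitude_global_solution:
  assumes "diagonal_matrix K1" "diagonal_matrix K2"
  obtains x where "solves_on (attitude_field K1 K2 u) UNIV {0..} x" "x 0 = x0"
proof -
  obtain p0 :: "real^2" and v0 :: "real^3" where x0: "x0 = (p0, v0)"
    by (cases x0)
  obtain X1 V1 where 1: "X1 0 = p0 $ 1 - u $ 1" "V1 0 = v0 $ 1"
    "\<And>t. (X1 has_real_derivative V1 t) (at t)"
    "\<And>t. (V1 has_real_derivative - K2 $ 1 $ 1 * V1 t - K1 $ 1 $ 1 * X1 t) (at t)"
    using damped_oscillator_solution by metis
  obtain X2 V2 where 2: "X2 0 = p0 $ 2 - u $ 2" "V2 0 = v0 $ 2"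
    "\<And>t. (X2 has_real_derivative V2 t) (at t)"
    "\<And>t. (V2 has_real_derivative - K2 $ 2 $ 2 * V2 t - K1 $ 2 $ 2 * X2 t) (at t)"
    using damped_oscillator_solution by metis
  define Z where "Z t = (v0 $ 3 - u $ 3) * exp (- K2 $ 3 $ 3 * t)" for t
  have Z: "(Z has_real_derivative - K2 $ 3 $ 3 * Z t) (at t)" for t
    unfolding Z_def[abs_def] by (auto intro!: derivative_eq_intros)
  define p :: "real \<Rightarrow> real^2" where "p t = vector [X1 t + u $ 1, X2 t + u $ 2]" for t
  define v :: "real \<Rightarrow> real^3" where "v t = vector [V1 t, V2 t, Z t + u $ 3]" for t
  show thesis
  proof (rule that[of "\<lambda>t. (p t, v t)"])
    show "solves_on (attitude_field K1 K2 u) UNIV {0..} (\<lambda>t. (p t, v t))"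
      unfolding solves_on_def has_vector_derivative_attitude_iff[OF assms]
      using 1(3,4) 2(3,4) Z
      by (auto simp: p_def v_def intro: has_field_derivative_at_within)
    show "(p 0, v 0) = x0"
      by (simp add: x0 p_def v_def vec_eq_iff forall_2 forall_3 1 2 Z_def)
  qed
qed

lemma attitude_exponentially_stable:
  assumes K1: "diagonal_matrix K1" "pos_def_matrix K1"
    and K2: "diagonal_matrix K2" "pos_def_matrix K2"
    and u: "u $ 2 \<in> pitch_range"
  shows "exponentially_stable (attitude_field K1 K2 u) attitude_domain (Pi_e3 *v u, e3e3T *v u)"
proof -
  let ?f = "attitude_field K1 K2 u" and ?xe = "(Pi_e3 *v u, e3e3T *v u)"
  obtain k \<gamma> where k: "k > 0" "\<gamma> > 0"
    and decay: "\<And>I x t. is_interval I \<Longrightarrow> 0 \<in> I \<Longrightarrow> I \<subseteq> {0..} \<Longrightarrow> solves_on ?f UNIV I x \<Longrightarrow> t \<in> I \<Longrightarrow>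
       norm (x t - ?xe) \<le> k * norm (x 0 - ?xe) * exp (- \<gamma> * t)"
    by (rule attitude_decay[OF K1 K2, of u]) (blast intro: that)
  \<comment> \<open>The pitch range is open, so \<open>r\<close> is a safety margin around the
    commanded pitch.\<close>
  obtain r where r: "r > 0" "ball (u $ 2) r \<subseteq> pitch_range"
    using u openE[of pitch_range "u $ 2"] by (auto simp: pitch_range_def)
  have near: "y \<in> attitude_domain" if "norm (y - ?xe) < r" for y
  proof -
    have "\<bar>fst y $ 2 - u $ 2\<bar> \<le> norm (fst y - Pi_e3 *v u)"
      using component_le_norm_cart[of "fst y - Pi_e3 *v u" 2] by (simp add: attitude_nth)
    also have "\<dots> \<le> norm (y - ?xe)"
      using norm_fst_le[of "fst y - Pi_e3 *v u" "snd y - e3e3T *v u"] by (cases y) simp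
    finally have "fst y $ 2 \<in> ball (u $ 2) r"
      using that by (simp add: dist_real_def)
    then show ?thesis
      using r by (auto simp: attitude_domain_def split: prod.split)
  qed
  \<comment> \<open>Starting within \<open>r / k\<close>, the global solution never moves further
    than \<open>r\<close> from the equilibrium, so it cannot leave the domain. This radius serves as
    \<open>c\<close> in \<open>exponentially_stable\<close>.\<close>
  have sol: "\<exists>x. solves_on ?f attitude_domain {0..} x \<and> x 0 = x0" if "norm (x0 - ?xe) < r / k" for x0
  proof -
    obtain x where x: "solves_on ?f UNIV {0..} x" "x 0 = x0"
      using attitude_global_solution[OF K1(1) K2(1)] by metis
    have "x t \<in> attitude_domain" if t: "t \<in> {0..}" for t
    proof (rule near)
      have "norm (x t - ?xe) \<le> k * norm (x 0 - ?xe) * exp (- \<gamma> * t)"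
        using t x(1) by (intro decay[of "{0..}"]) (auto simp: is_interval_ci)
      also have "\<dots> \<le> k * norm (x 0 - ?xe) * 1"
        using k t by (intro mult_left_mono) auto
      also have "\<dots> < r"
        using \<open>norm (x0 - ?xe) < r / k\<close> k x(2) by (simp add: field_simps)
      finally show "norm (x t - ?xe) < r" .
    qed
    then show ?thesis
      using x by (auto simp: solves_on_def)
  qed
  have est: "norm (x t - ?xe) \<le> k * norm (x0 - ?xe) * exp (- \<gamma> * t)"
    if "is_interval I \<and> 0 \<in> I \<and> I \<subseteq> {0..} \<and> solves_on ?f attitude_domain I x \<and> x 0 = x0" "t \<in> I" for I x x0 t
    \<comment> \<open>A solution in the domain is in particular one on \<open>UNIV\<close>.\<close>
    using that decay[of I x t] by (auto simp: solves_on_def)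
  have "?xe \<in> attitude_domain"
    using u by (simp add: attitude_domain_def attitude_nth)
  moreover have "?f ?xe = 0"
    by (simp add: attitude_field_def zero_prod_def vec_eq_iff forall_2 attitude_nth)
  moreover have "r / k > 0"
    using r k by simp
  ultimately show ?thesis
    unfolding exponentially_stable_def using k sol est by blast
qed

text \<open>The claim on \<open>attitude_state\<close> links the other two: controlled motions under
  constant input are trajectories of the field whose equilibrium is shown to be stable.\<close>

theorem theorem1:
  fixes J K2 :: "real^3^3" and K1 :: "real^2^2"
  assumes "transpose J = J" and "pos_def_matrix J"
    and "diagonal_matrix K1" and "pos_def_matrix K1"
    and "diagonal_matrix K2" and "pos_def_matrix K2"
  shows
    "(\<forall>(u :: real \<Rightarrow> real^3) I lam om.
        is_interval I \<and> interior I \<noteq> {} \<and> (\<forall>t\<in>I. u t $ 2 \<in> pitch_range) \<and>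
        controlled_motion J K1 K2 u I lam om \<longrightarrow>
          (\<forall>t\<in>I. ((\<lambda>s. vector_derivative lam (at s within I)) has_vector_derivative
             - (K2 *v (vector_derivative lam (at t within I) - e3e3T *v u t))
             - (transpose Pi_e3 ** K1 ** Pi_e3) *v (lam t - u t)) (at t within I)))
     \<and>
     (\<forall>u :: real^3. u $ 2 \<in> pitch_range \<longrightarrow>
        (\<forall>I lam om.
           is_interval I \<and> interior I \<noteq> {} \<and> controlled_motion J K1 K2 (\<lambda>_. u) I lam om \<longrightarrow>
             solves_on (attitude_field K1 K2 u) attitude_domain I (attitude_state I lam)) \<and>
        exponentially_stable (attitude_field K1 K2 u) attitude_domain
          (Pi_e3 *v u, e3e3T *v u))"
proof (rule conjI; intro allI impI)
  fix u :: "real \<Rightarrow> real^3" and I lam om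
  assume "is_interval I \<and> interior I \<noteq> {} \<and> (\<forall>t\<in>I. u t $ 2 \<in> pitch_range) \<and>
    controlled_motion J K1 K2 u I lam om"
  then show "\<forall>t\<in>I. ((\<lambda>s. vector_derivative lam (at s within I)) has_vector_derivative
       - (K2 *v (vector_derivative lam (at t within I) - e3e3T *v u t))
       - (transpose Pi_e3 ** K1 ** Pi_e3) *v (lam t - u t)) (at t within I)"
    using controlled_motion_second_order(2)[OF assms(2), unfolded pd_term_def] by blast
next
  fix u :: "real^3"
  assume "u $ 2 \<in> pitch_range"
  then show "(\<forall>I lam om.
      is_interval I \<and> interior I \<noteq> {} \<and> controlled_motion J K1 K2 (\<lambda>_. u) I lam om \<longrightarrow>
        solves_on (attitude_field K1 K2 u) attitude_domain I (attitude_state I lam)) \<and>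
    exponentially_stable (attitude_field K1 K2 u) attitude_domain (Pi_e3 *v u, e3e3T *v u)"
    using controlled_motion_attitude_state[OF assms(2)] attitude_exponentially_stable[OF assms(3-6)]
    by blast
qed

end
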